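(* Let $A\subset\mathbb{R}^d$ be a finite set. The multicover bifiltration $\mathrm{Cov}=(\mathrm{Cov}_{r,k})_{(r,k)\in[0,\infty)\times\mathbb{N}}$ of $A$ is weakly equivalent to the bifiltration $\textnormal{S-Del}=(\textnormal{S-Del}_{r,k})_{(r,k)\in[0,\infty)\times\mathbb{N}}$ (of geometric realizations of the simplicial complexes defined below).
   Context: $\mathbb{N}=\{1,2,3,\dots\}$. Bifiltrations here are indexed by $[0,\infty)\times\mathbb{N}$ with the order $(r,k)\le(r',k')$ iff $r\le r'$ and $k\ge k'$; a bifiltration is a family of topological spaces $X_{r,k}$ with $X_{r,k}\subseteq X_{r',k'}$ whenever $(r,k)\le(r',k')$. A morphism $\varphi:X\to Y$ of bifiltrations is a family of continuous maps $\varphi_{r,k}:X_{r,k}\to Y_{r,k}$ commuting with the inclusions; it is an objectwise homotopy equivalence if every $\varphi_{r,k}$ is a homotopy equivalence. $X$ and $Y$ are weakly equivalent if there is a finite zigzag $X\to Z_1\leftarrow Z_2\to\cdots\leftarrow Z_{m}\to\cdots\leftarrow Y$ of objectwise homotopy equivalences of bifiltrations connecting them. Multicover: $\mathrm{Cov}_{r,k}=\{b\in\mathbb{R}^d : \|b-a\|\le r \text{ for at least } k \text{ points } a\in A\}$. For $\tilde A\subseteq A$ let $\mathrm{Ball}_r(\tilde A)=\{b\in\mathbb{R}^d: \|b-\tilde a\|\le r \ \forall \tilde a\in\tilde A\}$ and, for $|\tilde A|=k$, the order-$k$ Voronoi region $\mathrm{Vor}(\tilde A)=\{b\in\mathbb{R}^d: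 \|b-\tilde a\|\le\|b-a\|\ \forall\tilde a\in\tilde A, a\in A\setminus\tilde A\}$. Let $\mathfrak{V}_{r,k}=\{\mathrm{Ball}_r(\tilde A)\cap\mathrm{Vor}(\tilde A): \tilde A\subseteq A, |\tilde A|=k\}$ (empty if $k>|A|$). Let $\mathrm{Del}^{+}_{r,k}$ be the nerve of $\mathfrak{V}_{r,k}\cup\mathfrak{V}_{r,k+1}$: the abstract simplicial complex whose vertices are subsets $\tilde A\subseteq A$ with $|\tilde A|\in\{k,k+1\}$ and whose simplices are the finite sets $\sigma$ of such subsets with $\bigcap_{\tilde A\in\sigma}\big(\mathrm{Ball}_r(\tilde A)\cap\mathrm{Vor}(\tilde A)\big)\neq\emptyset$. Define $\textnormal{S-Del}_{r,k}=\bigcup_{i\ge k}\mathrm{Del}^{+}_{r,i}$ (union of simplicial complexes on the common vertex set of subsets of $A$). *)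

theory Defs
  imports "HOL-Analysis.Analysis"
begin

definition idx_le :: "real \<Rightarrow> nat \<Rightarrow> real \<Rightarrow> nat \<Rightarrow> bool" where
  "idx_le r k r' k' \<longleftrightarrow> 0 \<le> r \<and> r \<le> r' \<and> 1 \<le> k' \<and> k' \<le> k"

definition is_bifiltration :: "(real \<Rightarrow> nat \<Rightarrow> 'b topology) \<Rightarrow> bool" where
  "is_bifiltration X \<longleftrightarrow>
     (\<forall>r k r' k'. idx_le r k r' k' \<longrightarrow>
        topspace (X r k) \<subseteq> topspace (X r' k') \<and> continuous_map (X r k) (X r' k') id)"

definition homotopy_equivalence_map :: "'b topology \<Rightarrow> 'c topology \<Rightarrow> ('b \<Rightarrow> 'c) \<Rightarrow> bool" where
  "homotopy_equivalence_map X Y f \<longleftrightarrow> continuous_map X Y f \<and>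
     (\<exists>g. continuous_map Y X g \<and>
          homotopic_with (\<lambda>h. True) X X (g \<circ> f) id \<and>
          homotopic_with (\<lambda>h. True) Y Y (f \<circ> g) id)"

definition objectwise_he ::
  "(real \<Rightarrow> nat \<Rightarrow> 'b topology) \<Rightarrow> (real \<Rightarrow> nat \<Rightarrow> 'c topology) \<Rightarrow> (real \<Rightarrow> nat \<Rightarrow> 'b \<Rightarrow> 'c) \<Rightarrow> bool" where
  "objectwise_he X Y \<phi> \<longleftrightarrow>
     (\<forall>r k. 0 \<le> r \<and> 1 \<le> k \<longrightarrow> homotopy_equivalence_map (X r k) (Y r k) (\<phi> r k)) \<and>
     (\<forall>r k r' k'. idx_le r k r' k' \<longrightarrow> (\<forall>x \<in> topspace (X r k). \<phi> r' k' x = \<phi> r k x))"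

definition he_linked ::
  "(real \<Rightarrow> nat \<Rightarrow> 'b topology) \<Rightarrow> (real \<Rightarrow> nat \<Rightarrow> 'c topology) \<Rightarrow> bool" where
  "he_linked X Y \<longleftrightarrow> (\<exists>\<phi>. objectwise_he X Y \<phi>) \<or> (\<exists>\<psi>. objectwise_he Y X \<psi>)"

definition weakly_equivalent ::
  "(real \<Rightarrow> nat \<Rightarrow> 'b topology) \<Rightarrow> (real \<Rightarrow> nat \<Rightarrow> 'c topology) \<Rightarrow> bool" where
  "weakly_equivalent X Y \<longleftrightarrow>
     (\<exists>(n::nat) (Z :: nat \<Rightarrow> real \<Rightarrow> nat \<Rightarrow> (nat \<Rightarrow> real) topology).
        (\<forall>i\<le>n. is_bifiltration (Z i)) \<and>
        he_linked X (Z 0) \<and>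
        (\<forall>i<n. he_linked (Z i) (Z (Suc i))) \<and>
        he_linked (Z n) Y)"

definition Cov :: "'a::euclidean_space set \<Rightarrow> real \<Rightarrow> nat \<Rightarrow> 'a set" where
  "Cov A r k = {b. k \<le> card {a \<in> A. norm (b - a) \<le> r}}"

definition Ball_r :: "real \<Rightarrow> 'a::euclidean_space set \<Rightarrow> 'a set" where
  "Ball_r r At = {b. \<forall>a \<in> At. norm (b - a) \<le> r}"

definition Vor :: "'a::euclidean_space set \<Rightarrow> 'a set \<Rightarrow> 'a set" where
  "Vor A At = {b. \<forall>c \<in> At. \<forall>a \<in> A - At. norm (b - c) \<le> norm (b - a)}"

text \<open>Del^+_{r,k}: nerve of the cells Ball_r(At) \<inter> Vor(At), |At| in {k, k+1};
  simplices are nonempty finite sets of vertices (vertices are subsets of A).\<close>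

definition Del_plus :: "'a::euclidean_space set \<Rightarrow> real \<Rightarrow> nat \<Rightarrow> 'a set set set" where
  "Del_plus A r k = {\<sigma>. finite \<sigma> \<and> \<sigma> \<noteq> {} \<and>
      (\<forall>At \<in> \<sigma>. At \<subseteq> A \<and> (card At = k \<or> card At = Suc k)) \<and>
      (\<Inter>At \<in> \<sigma>. Ball_r r At \<inter> Vor A At) \<noteq> {}}"

definition SDel :: "'a::euclidean_space set \<Rightarrow> real \<Rightarrow> nat \<Rightarrow> 'a set set set" where
  "SDel A r k = (\<Union>i \<in> {k..}. Del_plus A r i)"

text \<open>Geometric realization of an abstract simplicial complex K (set of finite vertex sets),
  as barycentric-coordinate functions with the (product) topology on 'v => real.\<close>

definition realization :: "'v set set \<Rightarrow> ('v \<Rightarrow> real) set" where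
  "realization K = {f. \<exists>\<sigma> \<in> K. (\<forall>v. v \<notin> \<sigma> \<longrightarrow> f v = 0) \<and> (\<forall>v \<in> \<sigma>. 0 \<le> f v) \<and> (\<Sum>v\<in>\<sigma>. f v) = 1}"

definition Cov_bifil :: "'a::euclidean_space set \<Rightarrow> real \<Rightarrow> nat \<Rightarrow> 'a topology" where
  "Cov_bifil A r k = subtopology euclidean (Cov A r k)"

definition SDel_bifil :: "'a::euclidean_space set \<Rightarrow> real \<Rightarrow> nat \<Rightarrow> ('a set \<Rightarrow> real) topology" where
  "SDel_bifil A r k = subtopology euclidean (realization (SDel A r k))"

end

theory Submission
  imports Defs
begin

text \<open>
  A single intermediate bifiltration suffices: the incidence space of pairs \<open>(x, f)\<close>, where \<open>f\<close> is
  a point of the realization of S-Del and \<open>x\<close> lies in every cell (ball intersected with Voronoi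
  region) that is a vertex of the support of \<open>f\<close>. Both projections commute with all inclusions. The
  fibres of the projection to S-Del are intersections of convex cells; the fibre over \<open>x\<close> of the
  projection to Cov is a chain of simplices, those on the cells of \<open>i\<close> and \<open>i + 1\<close> points containing
  \<open>x\<close>, and it deforms down the chain onto its lowest level \<open>k\<close>. Both homotopy inverses come from one
  averaging construction, which works for the closed cells because their nerve is unchanged by a
  small thickening over the compact set \<open>Cov A r k\<close>.
\<close>

section \<open>Continuous selections from convex sets\<close>

text \<open>
  A subset \<open>\<sigma>\<close> of \<open>V\<close> gets a positive weight at \<open>t\<close> only if it lies between \<open>{v. \<beta> v t = 0}\<close> and
  \<open>{v. \<alpha> v t > 0}\<close>; \<open>y t\<close> is the weighted mean of chosen common points of the \<open>C v\<close> with \<open>v \<in> \<sigma>\<close>.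
\<close>

lemma convex_selection:
  fixes C :: "'v \<Rightarrow> 'e::real_normed_vector set" and T :: "'t::topological_space set"
    and \<alpha> \<beta> :: "'v \<Rightarrow> 't \<Rightarrow> real"
  assumes "finite V" and conv: "\<And>v. v \<in> V \<Longrightarrow> convex (C v)"
    and cont: "\<And>v. v \<in> V \<Longrightarrow> continuous_on T (\<alpha> v)" "\<And>v. v \<in> V \<Longrightarrow> continuous_on T (\<beta> v)"
    and nonneg: "\<And>v t. v \<in> V \<Longrightarrow> t \<in> T \<Longrightarrow> 0 \<le> \<alpha> v t"
      "\<And>v t. v \<in> V \<Longrightarrow> t \<in> T \<Longrightarrow> 0 \<le> \<beta> v t"
    and pos: "\<And>v t. v \<in> V \<Longrightarrow> t \<in> T \<Longrightarrow> 0 < \<alpha> v t \<or> 0 < \<beta> v t"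
    and ne: "\<And>t. t \<in> T \<Longrightarrow> \<exists>x. \<forall>v\<in>V. 0 < \<alpha> v t \<longrightarrow> x \<in> C v"
  obtains y where "continuous_on T y" "\<And>t v. t \<in> T \<Longrightarrow> v \<in> V \<Longrightarrow> \<beta> v t = 0 \<Longrightarrow> y t \<in> C v"
proof
  \<comment> \<open>When the sets indexed by \<open>\<sigma>\<close> have no common point,
    \<open>c \<sigma>\<close> is arbitrary; by \<open>ne\<close>, such a \<open>\<sigma>\<close> has
    weight zero throughout \<open>T\<close>.\<close>
  define c where "c \<sigma> = (SOME x. \<forall>v\<in>\<sigma>. x \<in> C v)" for \<sigma>
  define w where "w \<sigma> t = (\<Prod>v\<in>\<sigma>. \<alpha> v t) * (\<Prod>v\<in>V - \<sigma>. \<beta> v t)" for \<sigma> t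
  define W where "W t = (\<Sum>\<sigma>\<in>Pow V. w \<sigma> t)" for t
  let ?y = "\<lambda>t. \<Sum>\<sigma>\<in>Pow V. (w \<sigma> t / W t) *\<^sub>R c \<sigma>"
  have w0: "0 \<le> w \<sigma> t" if "\<sigma> \<in> Pow V" "t \<in> T" for \<sigma> t
    using that nonneg unfolding w_def by (intro mult_nonneg_nonneg prod_nonneg) auto
  have W0: "0 < W t" if "t \<in> T" for t
  proof -
    \<comment> \<open>The set of all \<open>v\<close> with positive \<open>\<alpha>\<close> always
      has positive weight: outside it \<open>\<alpha>\<close> vanishes, so \<open>pos\<close> makes
      every \<open>\<beta>\<close> positive.\<close>
    let ?\<sigma> = "{v \<in> V. 0 < \<alpha> v t}"
    have "0 < w ?\<sigma> t"
      unfolding w_def using pos that by (intro mult_pos_pos prod_pos) auto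
    also have "\<dots> \<le> W t"
      unfolding W_def using w0 that \<open>finite V\<close> by (intro member_le_sum) auto
    finally show ?thesis .
  qed
  have contw: "continuous_on T (w \<sigma>)" if "\<sigma> \<in> Pow V" for \<sigma>
    unfolding w_def using that cont by (intro continuous_intros) auto
  show "continuous_on T ?y"
  proof (intro continuous_intros contw)
    show "continuous_on T W"
      unfolding W_def using contw by (intro continuous_intros)
    show "\<forall>t\<in>T. W t \<noteq> 0" using W0 by force
  qed
  fix t v assume t: "t \<in> T" and v: "v \<in> V" "\<beta> v t = 0"
  \<comment> \<open>If \<open>\<beta> v t = 0\<close>, a subset that omits \<open>v\<close> has a
    zero factor. So all points that contribute to the mean lie in the convex set
    \<open>C v\<close>.\<close>
  let ?N = "{\<sigma> \<in> Pow V. w \<sigma> t \<noteq> 0}"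
  have "c \<sigma> \<in> C v" if \<sigma>: "\<sigma> \<in> ?N" for \<sigma>
  proof -
    have fin: "finite \<sigma>" "finite (V - \<sigma>)" using \<sigma> \<open>finite V\<close> by (auto intro: finite_subset)
    have a: "\<forall>u\<in>\<sigma>. \<alpha> u t \<noteq> 0" and b: "\<forall>u\<in>V - \<sigma>. \<beta> u t \<noteq> 0"
      using \<sigma> fin by (auto simp: w_def)
    have "\<exists>x. \<forall>u\<in>\<sigma>. x \<in> C u"
      using ne[OF t] a nonneg(1)[OF _ t] \<sigma> by (force simp: less_le)
    then have "\<forall>u\<in>\<sigma>. c \<sigma> \<in> C u"
      unfolding c_def by (rule someI_ex)
    with b v show ?thesis by auto
  qed
  moreover have "(\<Sum>\<sigma>\<in>?N. w \<sigma> t / W t) = 1"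
  proof -
    have "(\<Sum>\<sigma>\<in>?N. w \<sigma> t / W t) = (\<Sum>\<sigma>\<in>Pow V. w \<sigma> t / W t)"
      using \<open>finite V\<close> by (intro sum.mono_neutral_left) auto
    then show ?thesis
      using W0[OF t] by (simp add: W_def flip: sum_divide_distrib)
  qed
  ultimately have "(\<Sum>\<sigma>\<in>?N. (w \<sigma> t / W t) *\<^sub>R c \<sigma>) \<in> C v"
  proof (intro convex_sum)
    show "0 \<le> w \<sigma> t / W t" if "\<sigma> \<in> ?N" for \<sigma>
      using w0[OF _ t] W0[OF t] that by simp
  qed (use \<open>finite V\<close> conv v in auto)
  also have "(\<Sum>\<sigma>\<in>?N. (w \<sigma> t / W t) *\<^sub>R c \<sigma>) = ?y t"
    using \<open>finite V\<close> by (intro sum.mono_neutral_left) auto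
  finally show "?y t \<in> C v" .
qed

section \<open>Cells of order-k Voronoi diagrams\<close>

definition cell :: "'a::euclidean_space set \<Rightarrow> real \<Rightarrow> 'a set \<Rightarrow> 'a set" where
  "cell A r v = Ball_r r v \<inter> Vor A v"

lemma Ball_r_eq: "Ball_r r v = (\<Inter>a\<in>v. cball a r)"
  by (auto simp: Ball_r_def dist_norm norm_minus_commute)

text \<open>Squaring cancels \<open>b \<bullet> b\<close>, which leaves a condition linear in
  \<open>b\<close>. Voronoi regions are thus intersections of closed half-spaces, hence convex and
  closed.\<close>

lemma norm_diff_le_iff:
  fixes a b c :: "'a::real_inner"
  shows "norm (b - c) \<le> norm (b - a) \<longleftrightarrow> (2 *\<^sub>R (a - c)) \<bullet> b \<le> a \<bullet> a - c \<bullet> c"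
  by (simp add: norm_le inner_diff_left inner_diff_right inner_commute algebra_simps)

lemma Vor_eq:
  "Vor A v = (\<Inter>c\<in>v. \<Inter>a\<in>A - v. {b. (2 *\<^sub>R (a - c)) \<bullet> b \<le> a \<bullet> a - c \<bullet> c})"
  unfolding Vor_def norm_diff_le_iff by blast

lemma convex_cell: "convex (cell A r v)"
  unfolding cell_def Ball_r_eq Vor_eq
  by (intro convex_Int convex_INT convex_cball convex_halfspace_le)

lemma compact_Ball_r: "v \<noteq> {} \<Longrightarrow> compact (Ball_r r v)"
  unfolding Ball_r_eq by (intro compact_Inter) auto

lemma closed_cell: "closed (cell A r v)"
  unfolding cell_def Ball_r_eq Vor_eq
  by (intro closed_Int closed_INT ballI closed_cball closed_halfspace_le)

lemma cell_mono: "r \<le> r' \<Longrightarrow> cell A r v \<subseteq> cell A r' v"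
  unfolding cell_def Ball_r_def by force

section \<open>The multicover as a union of cells\<close>

lemma Cov_antimono: "i \<le> j \<Longrightarrow> Cov A r j \<subseteq> Cov A r i"
  unfolding Cov_def by auto

lemma cell_subset_Cov:
  assumes "finite A" "v \<subseteq> A"
  shows "cell A r v \<subseteq> Cov A r (card v)"
proof
  fix x assume "x \<in> cell A r v"
  then have "v \<subseteq> {a \<in> A. norm (x - a) \<le> r}"
    using assms by (auto simp: cell_def Ball_r_def)
  then show "x \<in> Cov A r (card v)"
    unfolding Cov_def using assms(1) by (simp add: card_mono)
qed

text \<open>Greedy choice: adjoin a minimiser of \<open>d\<close> among the remaining elements, with
  ties broken arbitrarily. For \<open>d\<close> the distance to a point, this yields its
  \<open>i\<close> nearest sites.\<close>

lemma exists_initial_subset: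
  fixes d :: "'b \<Rightarrow> real"
  assumes "finite A" "i \<le> card A"
  shows "\<exists>v\<subseteq>A. card v = i \<and> (\<forall>c\<in>v. \<forall>a\<in>A - v. d c \<le> d a)"
  using assms(2)
proof (induction i)
  case 0
  then show ?case by (intro exI[of _ "{}"]) auto
next
  case (Suc i)
  then obtain v where v: "v \<subseteq> A" "card v = i" "\<forall>c\<in>v. \<forall>a\<in>A - v. d c \<le> d a"
    by auto
  have "finite v" using v assms finite_subset by blast
  have "A - v \<noteq> {}"
    using v Suc.prems assms by (metis Diff_eq_empty_iff card_mono not_less_eq_eq \<open>finite v\<close>)
  then obtain m where m: "m \<in> A - v" "\<forall>a\<in>A - v. d m \<le> d a"
    using ex_is_arg_min_if_finite[of "A - v" d] assms(1)
    by (auto simp: is_arg_min_linorder)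
  then show ?case
    using v \<open>finite v\<close> by (intro exI[of _ "insert m v"]) auto
qed

lemma Cov_in_cell:
  assumes "finite A" "x \<in> Cov A r i"
  obtains v where "v \<subseteq> A" "card v = i" "x \<in> cell A r v"
proof -
  let ?B = "{a \<in> A. norm (x - a) \<le> r}"
  have i: "i \<le> card ?B" using assms by (simp add: Cov_def)
  also have "\<dots> \<le> card A" using assms by (intro card_mono) auto
  finally obtain v where v: "v \<subseteq> A" "card v = i"
      "\<forall>c\<in>v. \<forall>a\<in>A - v. norm (x - c) \<le> norm (x - a)"
    using exists_initial_subset[OF assms(1), of i "\<lambda>a. norm (x - a)"] by auto
  have "norm (x - c) \<le> r" if "c \<in> v" for c
  proof (rule ccontr)
    \<comment> \<open>If a chosen site \<open>c\<close> were farther than \<open>r\<close>, so would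
      be every unchosen one. All sites within \<open>r\<close> would then lie in
      \<open>v - {c}\<close>, which has fewer than \<open>i\<close> elements.\<close>
    assume far: "\<not> norm (x - c) \<le> r"
    then have "?B \<subseteq> v - {c}" using v(3) that by force
    moreover have "finite v" using v assms finite_subset by blast
    ultimately have "card ?B \<le> card (v - {c})" "card (v - {c}) < card v"
      using that by (simp_all only: card_mono card_Diff1_less finite_Diff)
    with i v(2) show False by simp
  qed
  with v have "x \<in> cell A r v"
    by (auto simp: cell_def Ball_r_def Vor_def)
  with v that show ?thesis by blast
qed

lemma compact_Cov:
  assumes "finite A" "1 \<le> k"
  shows "compact (Cov A r k)"
proof -
  have "Cov A r k = (\<Union>v\<in>{v. v \<subseteq> A \<and> card v = k}. cell A r v)"
  proof (intro equalityI subsetI)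
    fix x assume "x \<in> Cov A r k"
    then obtain v where "v \<subseteq> A" "card v = k" "x \<in> cell A r v"
      by (rule Cov_in_cell[OF assms(1)])
    then show "x \<in> (\<Union>v\<in>{v. v \<subseteq> A \<and> card v = k}. cell A r v)" by blast
  qed (use cell_subset_Cov[OF assms(1)] in blast)
  moreover have "compact (cell A r v)" if "v \<subseteq> A" "card v = k" for v
  proof -
    \<comment> \<open>Here \<open>k \<ge> 1\<close> enters: the ball condition bounds the cell only
      if it has a centre.\<close>
    have "v \<noteq> {}" using that assms by auto
    then show ?thesis
      using closed_cell[of A r v] compact_Ball_r[of v r]
      by (metis cell_def compact_Int_closed inf.left_idem)
  qed
  ultimately show ?thesis
    using assms(1) by (auto intro!: compact_UN)
qed

section \<open>Stability of the nerve under small thickening\<close>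

text \<open>If the sets of \<open>\<sigma>\<close> have no common point, the sum of the distances to
  them is continuous and positive on the compact \<open>X\<close>, hence bounded away from 0. The
  least of the finitely many resulting bounds serves every \<open>\<sigma>\<close>.\<close>

lemma thickened_nerve:
  fixes C :: "'v \<Rightarrow> 'e::euclidean_space set"
  assumes "compact X" "finite V"
    and C: "\<And>v. v \<in> V \<Longrightarrow> closed (C v)" "\<And>v. v \<in> V \<Longrightarrow> C v \<noteq> {}"
  shows "\<exists>\<epsilon>>0. \<forall>x\<in>X. \<forall>\<sigma>\<subseteq>V. (\<forall>v\<in>\<sigma>. infdist x (C v) < \<epsilon>) \<longrightarrow> (\<exists>z. \<forall>v\<in>\<sigma>. z \<in> C v)"
proof -
  have "\<exists>e>0. \<forall>x\<in>X. (\<forall>v\<in>\<sigma>. infdist x (C v) < e) \<longrightarrow> (\<exists>z. \<forall>v\<in>\<sigma>. z \<in> C v)"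
    if "\<sigma> \<in> Pow V" for \<sigma>
  proof (cases "X = {} \<or> (\<exists>z. \<forall>v\<in>\<sigma>. z \<in> C v)")
    case True
    then show ?thesis by (intro exI[of _ 1]) auto
  next
    case False
    have fin: "finite \<sigma>" using that assms(2) finite_subset by auto
    define F where "F x = (\<Sum>v\<in>\<sigma>. infdist x (C v))" for x
    have "continuous_on X F"
      unfolding F_def by (intro continuous_intros)
    with False assms(1) obtain m where m: "m \<in> X" "\<forall>x\<in>X. F m \<le> F x"
      by (metis continuous_attains_inf)
    have "0 < F m"
    proof -
      obtain v where v: "v \<in> \<sigma>" "m \<notin> C v" using False by auto
      have "0 < infdist m (C v)"
        using C v that by (meson PowD infdist_pos_not_in_closed subsetD)
      also have "\<dots> \<le> F m"
        unfolding F_def using fin v by (intro member_le_sum) (auto simp: infdist_nonneg)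
      finally show ?thesis .
    qed
    \<comment> \<open>The \<open>+ 1\<close> in the denominator makes the summed bound strictly
      smaller than the minimum \<open>F m\<close>.\<close>
    moreover have False if x: "x \<in> X" and d: "\<forall>v\<in>\<sigma>. infdist x (C v) < F m / (card \<sigma> + 1)" for x
    proof -
      have "F x \<le> of_nat (card \<sigma>) * (F m / (card \<sigma> + 1))"
        unfolding F_def[of x] by (rule sum_bounded_above) (use d less_imp_le in blast)
      also have "\<dots> < F m"
        using \<open>0 < F m\<close> by (simp add: field_simps)
      finally show False using m x by force
    qed
    ultimately show ?thesis
      by (intro exI[of _ "F m / (card \<sigma> + 1)"]) (auto simp: add_pos_nonneg)
  qed
  then obtain e where e: "\<And>\<sigma>. \<sigma> \<in> Pow V \<Longrightarrow> 0 < e \<sigma>"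
    "\<And>\<sigma> x. \<sigma> \<in> Pow V \<Longrightarrow> x \<in> X \<Longrightarrow> (\<forall>v\<in>\<sigma>. infdist x (C v) < e \<sigma>) \<Longrightarrow> (\<exists>z. \<forall>v\<in>\<sigma>. z \<in> C v)"
    by metis
  let ?\<epsilon> = "Min (e ` Pow V)"
  have fin: "finite (e ` Pow V)" "e ` Pow V \<noteq> {}" using assms(2) by auto
  have "0 < ?\<epsilon>"
    using e(1) fin by (subst Min_gr_iff) auto
  moreover have "\<exists>z. \<forall>v\<in>\<sigma>. z \<in> C v"
    if "x \<in> X" "\<sigma> \<subseteq> V" "\<forall>v\<in>\<sigma>. infdist x (C v) < ?\<epsilon>" for x \<sigma>
  proof -
    have "?\<epsilon> \<le> e \<sigma>" using fin that(2) by (intro Min_le) auto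
    then show ?thesis using e(2)[of \<sigma> x] that by force
  qed
  ultimately show ?thesis by blast
qed

section \<open>The incidence space and its projection to the realization\<close>

text \<open>The point \<open>x\<close> certifies that the support of \<open>f\<close> is a simplex
  of \<open>Del_plus A r i\<close>, so no complex has to be mentioned. Summing over all of
  \<open>Pow A\<close> keeps the index set fixed while the support varies.\<close>

definition incidence :: "'a::euclidean_space set \<Rightarrow> real \<Rightarrow> nat \<Rightarrow> ('a \<times> ('a set \<Rightarrow> real)) set" where
  "incidence A r k = {(x, f). (\<forall>v. 0 \<le> f v) \<and> (\<forall>v. f v \<noteq> 0 \<longrightarrow> v \<subseteq> A \<and> x \<in> cell A r v) \<and>
     (\<exists>i\<ge>k. \<forall>v. f v \<noteq> 0 \<longrightarrow> card v = i \<or> card v = Suc i) \<and> (\<Sum>v\<in>Pow A. f v) = 1}"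

lemma incidenceI:
  assumes "\<And>v. 0 \<le> f v" "\<And>v. f v \<noteq> 0 \<Longrightarrow> v \<subseteq> A" "\<And>v. f v \<noteq> 0 \<Longrightarrow> x \<in> cell A r v"
    "k \<le> i" "\<And>v. f v \<noteq> 0 \<Longrightarrow> card v = i \<or> card v = Suc i" "(\<Sum>v\<in>Pow A. f v) = 1"
  shows "(x, f) \<in> incidence A r k"
  using assms unfolding incidence_def by blast

lemma incidenceE:
  assumes "(x, f) \<in> incidence A r k"
  obtains i where "\<And>v. 0 \<le> f v" "\<And>v. f v \<noteq> 0 \<Longrightarrow> v \<subseteq> A" "\<And>v. f v \<noteq> 0 \<Longrightarrow> x \<in> cell A r v"
    "k \<le> i" "\<And>v. f v \<noteq> 0 \<Longrightarrow> card v = i \<or> card v = Suc i" "(\<Sum>v\<in>Pow A. f v) = 1"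
  using assms unfolding incidence_def by blast

text \<open>Shrinking the support keeps the level \<open>i\<close>, and the base point may move
  freely inside the remaining cells.\<close>

lemma incidence_support_mono:
  assumes "(x, f) \<in> incidence A r k"
    and "\<And>v. 0 \<le> g v" "\<And>v. g v \<noteq> 0 \<Longrightarrow> f v \<noteq> 0" "(\<Sum>v\<in>Pow A. g v) = 1"
    and "\<And>v. g v \<noteq> 0 \<Longrightarrow> y \<in> cell A r v"
  shows "(y, g) \<in> incidence A r k"
  using assms(1)
proof (rule incidenceE)
  fix i assume "\<And>v. f v \<noteq> 0 \<Longrightarrow> v \<subseteq> A" "k \<le> i" "\<And>v. f v \<noteq> 0 \<Longrightarrow> card v = i \<or> card v = Suc i"
  with assms(2-5) show ?thesis by (intro incidenceI[where i = i]) auto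
qed

text \<open>Used for straight-line homotopies in \<open>f\<close> over a fixed \<open>x\<close>. The
  level of \<open>f\<close> is ambiguous when its support has a single cardinality, so
  \<open>g\<close> is required to fit every level that fits \<open>f\<close>.\<close>

lemma incidence_convex_combination:
  assumes xf: "(x, f) \<in> incidence A r k" and s: "0 \<le> s" "s \<le> 1"
    and g: "\<And>v. 0 \<le> g v" "\<And>v. g v \<noteq> 0 \<Longrightarrow> v \<subseteq> A" "\<And>v. g v \<noteq> 0 \<Longrightarrow> x \<in> cell A r v"
      "(\<Sum>v\<in>Pow A. g v) = 1"
    and card: "\<And>i. (\<And>v. f v \<noteq> 0 \<Longrightarrow> card v = i \<or> card v = Suc i) \<Longrightarrow>
      (\<And>v. g v \<noteq> 0 \<Longrightarrow> card v = i \<or> card v = Suc i)"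
  shows "(x, \<lambda>v. (1 - s) * f v + s * g v) \<in> incidence A r k"
  using xf
proof (rule incidenceE)
  fix i assume f: "\<And>v. 0 \<le> f v" "\<And>v. f v \<noteq> 0 \<Longrightarrow> v \<subseteq> A" "\<And>v. f v \<noteq> 0 \<Longrightarrow> x \<in> cell A r v"
    "k \<le> i" "\<And>v. f v \<noteq> 0 \<Longrightarrow> card v = i \<or> card v = Suc i" "(\<Sum>v\<in>Pow A. f v) = 1"
  have supp: "f v \<noteq> 0 \<or> g v \<noteq> 0" if "(1 - s) * f v + s * g v \<noteq> 0" for v
    using that by auto
  have "(\<Sum>v\<in>Pow A. (1 - s) * f v + s * g v) = (1 - s) * (\<Sum>v\<in>Pow A. f v) + s * (\<Sum>v\<in>Pow A. g v)"
    by (simp add: sum.distrib sum_distrib_left)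
  with f(6) g(4) have "(\<Sum>v\<in>Pow A. (1 - s) * f v + s * g v) = 1" by simp
  then show ?thesis
  proof (intro incidenceI[where i = i])
    show "0 \<le> (1 - s) * f v + s * g v" for v using f(1) g(1) s by simp
    show "v \<subseteq> A" if "(1 - s) * f v + s * g v \<noteq> 0" for v
      using supp[OF that] f(2) g(2) by blast
    show "x \<in> cell A r v" if "(1 - s) * f v + s * g v \<noteq> 0" for v
      using supp[OF that] f(3) g(3) by blast
    show "card v = i \<or> card v = Suc i" if "(1 - s) * f v + s * g v \<noteq> 0" for v
      using supp[OF that]
    proof
      assume "g v \<noteq> 0"
      with f(5) show ?thesis by (rule card[of i v])
    qed (rule f(5))
  qed (rule f(4))
qed

text \<open>Any common point of the cells of a simplex supplies \<open>x\<close>. Conversely the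
  support is itself a simplex, nonempty because the coordinates sum to 1.\<close>

lemma realization_SDel:
  assumes "finite A"
  shows "realization (SDel A r k) = snd ` incidence A r k"
proof (intro equalityI subsetI)
  fix f assume "f \<in> realization (SDel A r k)"
  then obtain \<sigma> i where \<sigma>: "k \<le> i" "\<sigma> \<in> Del_plus A r i" "\<And>v. v \<notin> \<sigma> \<Longrightarrow> f v = 0"
      "\<And>v. v \<in> \<sigma> \<Longrightarrow> 0 \<le> f v" "(\<Sum>v\<in>\<sigma>. f v) = 1"
    by (auto simp: realization_def SDel_def)
  from \<sigma>(2) obtain x where x: "\<And>v. v \<in> \<sigma> \<Longrightarrow> x \<in> cell A r v"
    unfolding Del_plus_def cell_def by blast
  have \<sigma>A: "\<And>v. v \<in> \<sigma> \<Longrightarrow> v \<subseteq> A \<and> (card v = i \<or> card v = Suc i)"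
    using \<sigma>(2) by (auto simp: Del_plus_def)
  have "(\<Sum>v\<in>\<sigma>. f v) = (\<Sum>v\<in>Pow A. f v)"
    using assms \<sigma>A \<sigma>(3) by (intro sum.mono_neutral_left) auto
  then have "(x, f) \<in> incidence A r k"
    using \<sigma>(1,3-5) \<sigma>A x by (intro incidenceI[where i = i]) (metis order_refl)+
  then show "f \<in> snd ` incidence A r k" by force
next
  fix f assume "f \<in> snd ` incidence A r k"
  then obtain x where "(x, f) \<in> incidence A r k" by auto
  then show "f \<in> realization (SDel A r k)"
  proof (rule incidenceE)
    fix i assume f: "\<And>v. 0 \<le> f v" "\<And>v. f v \<noteq> 0 \<Longrightarrow> v \<subseteq> A" "\<And>v. f v \<noteq> 0 \<Longrightarrow> x \<in> cell A r v"
      "k \<le> i" "\<And>v. f v \<noteq> 0 \<Longrightarrow> card v = i \<or> card v = Suc i" "(\<Sum>v\<in>Pow A. f v) = 1"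
    let ?\<sigma> = "{v. f v \<noteq> 0}"
    have sub: "?\<sigma> \<subseteq> Pow A" using f(2) by auto
    have "(\<Sum>v\<in>?\<sigma>. f v) = (\<Sum>v\<in>Pow A. f v)"
      using assms sub by (intro sum.mono_neutral_left) auto
    then have sum1: "(\<Sum>v\<in>?\<sigma>. f v) = 1" using f(6) by simp
    then have ne: "?\<sigma> \<noteq> {}" by (metis sum.empty zero_neq_one)
    have "?\<sigma> \<in> Del_plus A r i"
    proof -
      have "x \<in> (\<Inter>v\<in>?\<sigma>. cell A r v)" using f(3) by blast
      moreover have "finite ?\<sigma>" using sub assms by (meson finite_Pow_iff finite_subset)
      ultimately show ?thesis
        unfolding Del_plus_def cell_def[symmetric] using ne sub f(5) by blast
    qed
    then have "?\<sigma> \<in> SDel A r k" using f(4) by (auto simp: SDel_def)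
    then show ?thesis
      unfolding realization_def using f(1) sum1
      by (intro CollectI bexI[of _ ?\<sigma>]) auto
  qed
qed

lemma incidence_mono:
  assumes "r \<le> r'" "k' \<le> k"
  shows "incidence A r k \<subseteq> incidence A r' k'"
proof clarify
  fix x f assume "(x, f) \<in> incidence A r k"
  then show "(x, f) \<in> incidence A r' k'"
  proof (rule incidenceE)
    fix i assume f: "\<And>v. 0 \<le> f v" "\<And>v. f v \<noteq> 0 \<Longrightarrow> v \<subseteq> A" "\<And>v. f v \<noteq> 0 \<Longrightarrow> x \<in> cell A r v"
      "k \<le> i" "\<And>v. f v \<noteq> 0 \<Longrightarrow> card v = i \<or> card v = Suc i" "(\<Sum>v\<in>Pow A. f v) = 1"
    then show ?thesis
      using assms(2) subsetD[OF cell_mono[OF assms(1)]]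
      by (intro incidenceI[where i = i]) (blast | linarith)+
  qed
qed

section \<open>The homotopy inverse of the projection to the realization\<close>

lemma homotopic_into_top_of_set:
  fixes S :: "'b::topological_space set" and T :: "'c::topological_space set" and H :: "real \<times> 'b \<Rightarrow> 'c"
  assumes cont: "continuous_on ({0..1} \<times> S) H"
    and mem: "\<And>s z. 0 \<le> s \<Longrightarrow> s \<le> 1 \<Longrightarrow> z \<in> S \<Longrightarrow> H (s, z) \<in> T"
    and ends: "\<And>z. z \<in> S \<Longrightarrow> H (0, z) = F z" "\<And>z. z \<in> S \<Longrightarrow> H (1, z) = G z"
  shows "homotopic_with (\<lambda>h. True) (top_of_set S) (top_of_set T) F G"
proof -
  have "continuous_map (top_of_set ({0..1} \<times> S)) (top_of_set T) H"
    using cont mem by auto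
  then have "homotopic_with (\<lambda>h. True) (top_of_set S) (top_of_set T) (\<lambda>z. H (0, z)) (\<lambda>z. H (1, z))"
    unfolding homotopic_with_def by (intro exI[of _ H]) simp
  then show ?thesis
    by (rule homotopic_with_eq) (use ends in auto)
qed

text \<open>A continuous choice \<open>y f\<close> can be made to lie in the cells whose weight is
  at least \<open>c\<close>, but perhaps not in those of small weight. The inverse therefore pairs
  \<open>y f\<close> with the truncation \<open>h f\<close>, whose support avoids small
  weights.\<close>

lemma homotopy_equivalence_snd:
  fixes A :: "'a::euclidean_space set"
  assumes "finite A"
  shows "homotopy_equivalence_map (top_of_set (incidence A r k))
    (top_of_set (snd ` incidence A r k)) snd"
proof -
  let ?Z = "incidence A r k" and ?K = "snd ` incidence A r k"
  \<comment> \<open>Some coordinate of a point of the realization is at least twice \<open>c\<close>, so cutting off at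
    \<open>c\<close> shrinks the support without emptying it.\<close>
  define c :: real where "c = 1 / (2 * card (Pow A))"
  have cardP: "0 < card (Pow A)" using assms by (simp add: card_Pow)
  have c0: "0 < c" using cardP by (simp add: c_def)
  define u where "u f v = (if v \<in> Pow A then max 0 (f v - c) else 0)" for f :: "'a set \<Rightarrow> real" and v
  define U where "U f = (\<Sum>v\<in>Pow A. u f v)" for f
  define h where "h f v = u f v / U f" for f v
  have coord: "continuous_on S (\<lambda>f. f v)" for S :: "('a set \<Rightarrow> real) set" and v
    by (rule continuous_on_product_then_coordinatewise[OF continuous_on_id])
  have u0: "0 \<le> u f v" for f v by (simp add: u_def)
  have U0: "0 < U f" if "(x, f) \<in> ?Z" for x f
  proof -
    have sum1: "(\<Sum>v\<in>Pow A. f v) = 1" using that by (auto simp: incidence_def)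
    have "\<exists>v\<in>Pow A. c < f v"
    proof (rule ccontr)
      assume "\<not> (\<exists>v\<in>Pow A. c < f v)"
      then have "(\<Sum>v\<in>Pow A. f v) \<le> of_nat (card (Pow A)) * c"
        by (intro sum_bounded_above) (meson not_le)
      also have "\<dots> < 1" using cardP by (simp add: c_def)
      finally show False using sum1 by simp
    qed
    then obtain v where v: "v \<in> Pow A" "c < f v" by blast
    then have "0 < u f v" by (simp add: u_def)
    also have "\<dots> \<le> U f" unfolding U_def using v assms u0 by (intro member_le_sum) auto
    finally show ?thesis .
  qed
  have conth: "continuous_on ?K (\<lambda>f. h f v)" for v
  proof -
    have cu: "continuous_on ?K (\<lambda>f. u f w)" for w
    proof (cases "w \<in> Pow A")
      case True
      then show ?thesis unfolding u_def by (auto intro!: continuous_intros coord)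
    next
      case False
      then show ?thesis unfolding u_def by (auto intro!: continuous_intros)
    qed
    have "continuous_on ?K U"
      unfolding U_def by (intro continuous_intros cu)
    then show ?thesis
      unfolding h_def using U0 by (intro continuous_intros cu) force+
  qed
  have h0: "0 \<le> h f v" if "(x, f) \<in> ?Z" for x f v
    using u0 U0[OF that] by (simp add: h_def less_imp_le)
  have hsum: "(\<Sum>v\<in>Pow A. h f v) = 1" if "(x, f) \<in> ?Z" for x f
    using U0[OF that] by (simp add: h_def U_def flip: sum_divide_distrib)
  have hsupp: "v \<in> Pow A" "c < f v" if "h f v \<noteq> 0" for f v
    using that by (auto simp: h_def u_def split: if_splits)
  \<comment> \<open>With \<open>\<alpha>\<close> the weight itself, only subsets of the support are
    averaged over; these have a common point. The function \<open>\<beta>\<close> vanishes exactly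
    where the weight is at least \<open>c\<close>.\<close>
  obtain y where y: "continuous_on ?K y"
    "\<And>f v. f \<in> ?K \<Longrightarrow> v \<in> Pow A \<Longrightarrow> max 0 (c - f v) = 0 \<Longrightarrow> y f \<in> cell A r v"
  proof (rule convex_selection[where V = "Pow A" and C = "cell A r" and T = ?K
        and \<alpha> = "\<lambda>v f. f v" and \<beta> = "\<lambda>v f. max 0 (c - f v)"])
    show "continuous_on ?K (\<lambda>f. max 0 (c - f v))" for v
      by (intro continuous_intros coord)
    show "\<exists>x. \<forall>v\<in>Pow A. 0 < f v \<longrightarrow> x \<in> cell A r v" if "f \<in> ?K" for f
      using that by (force simp: incidence_def)
    show "0 \<le> f v" if "f \<in> ?K" for f and v :: "'a set"
      using that by (auto simp: incidence_def)
    show "0 < f v \<or> 0 < max 0 (c - f v)" for f and v :: "'a set"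
      using c0 by auto
  qed (use assms convex_cell coord in \<open>auto\<close>)
  have yh: "y f \<in> cell A r v" if "f \<in> ?K" "h f v \<noteq> 0" for f v
    using y(2)[OF that(1)] hsupp[OF that(2)] by auto
  have hmem: "(x, h f) \<in> ?Z" if "(x, f) \<in> ?Z" for x f
  proof (rule incidence_support_mono[OF that])
    show "f v \<noteq> 0" if "h f v \<noteq> 0" for v using hsupp[OF that] c0 by auto
    then show "x \<in> cell A r v" if "h f v \<noteq> 0" for v
      using that \<open>(x, f) \<in> ?Z\<close> by (auto simp: incidence_def)
  qed (use h0[OF that] hsum[OF that] in auto)
  have lin: "(x, \<lambda>v. (1 - s) * f v + s * h f v) \<in> ?Z"
    if "(x, f) \<in> ?Z" "0 \<le> s" "s \<le> 1" for x f s
  proof (rule incidence_convex_combination[OF that])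
    show "x \<in> cell A r v" if "h f v \<noteq> 0" for v
      using that hmem[OF \<open>(x, f) \<in> ?Z\<close>] by (auto simp: incidence_def)
    fix i and v :: "'a set"
    assume "\<And>v. f v \<noteq> 0 \<Longrightarrow> card v = i \<or> card v = Suc i" "h f v \<noteq> 0"
    moreover from this have "f v \<noteq> 0" using hsupp[of f v] c0 by linarith
    ultimately show "card v = i \<or> card v = Suc i" by blast
  qed (use h0[OF that(1)] hsum[OF that(1)] hsupp in auto)
  \<comment> \<open>Both \<open>x\<close> and \<open>y f\<close> lie in each cell that supports
    \<open>h f\<close>, and by convexity so does the segment between them.\<close>
  have yhmem: "((1 - s) *\<^sub>R x + s *\<^sub>R y f, h f) \<in> ?Z"
    if z: "(x, f) \<in> ?Z" and s: "0 \<le> s" "s \<le> 1" for x f s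
  proof (rule incidence_support_mono[OF hmem[OF z]])
    show "(1 - s) *\<^sub>R x + s *\<^sub>R y f \<in> cell A r v" if "h f v \<noteq> 0" for v
    proof (rule convexD_alt[OF convex_cell _ _ s])
      show "x \<in> cell A r v" using hmem[OF z] that by (auto simp: incidence_def)
      show "y f \<in> cell A r v" using yh that z by force
    qed
  qed (use h0[OF z] hsum[OF z] in auto)
  let ?g = "\<lambda>f. (y f, h f)"
  have K: "f \<in> ?K" if "(x, f) \<in> ?Z" for x f using that by force
  have contK: "continuous_on S (\<lambda>z. h (F z) v)" "continuous_on S (\<lambda>z. y (F z))"
    if "continuous_on S F" "F ` S \<subseteq> ?K" for F :: "'c::topological_space \<Rightarrow> 'a set \<Rightarrow> real" and S v
    using continuous_on_compose2[OF conth that] continuous_on_compose2[OF y(1) that] by auto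
  have K_id: "homotopic_with (\<lambda>h. True) (top_of_set ?K) (top_of_set ?K) id h"
  proof (rule homotopic_into_top_of_set[where H = "\<lambda>(s, f) v. (1 - s) * f v + s * h f v"])
    show "continuous_on ({0..1} \<times> ?K) (\<lambda>(s, f) v. (1 - s) * f v + s * h f v)"
      unfolding case_prod_beta
      by (intro continuous_intros contK continuous_on_product_then_coordinatewise) auto
  qed (use lin in \<open>auto simp: image_iff\<close>, force)
  \<comment> \<open>The homotopy to the inverse has two stages. The support is shrunk first, because
    \<open>y f\<close> need not lie in the discarded cells; only then does \<open>x\<close> slide to
    \<open>y f\<close>.\<close>
  have id_h: "homotopic_with (\<lambda>h. True) (top_of_set ?Z) (top_of_set ?Z) id (\<lambda>z. (fst z, h (snd z)))"
  proof (rule homotopic_into_top_of_set[where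
        H = "\<lambda>(s, z). (fst z, \<lambda>v. (1 - s) * snd z v + s * h (snd z) v)"])
    show "continuous_on ({0..1} \<times> ?Z) (\<lambda>(s, z). (fst z, \<lambda>v. (1 - s) * snd z v + s * h (snd z) v))"
      unfolding case_prod_beta
      by (intro continuous_intros contK continuous_on_product_then_coordinatewise) auto
  qed (use lin in auto)
  have h_gf: "homotopic_with (\<lambda>h. True) (top_of_set ?Z) (top_of_set ?Z) (\<lambda>z. (fst z, h (snd z))) (?g \<circ> snd)"
  proof (rule homotopic_into_top_of_set[where
        H = "\<lambda>(s, z). ((1 - s) *\<^sub>R fst z + s *\<^sub>R y (snd z), h (snd z))"])
    show "continuous_on ({0..1} \<times> ?Z) (\<lambda>(s, z). ((1 - s) *\<^sub>R fst z + s *\<^sub>R y (snd z), h (snd z)))"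
      unfolding case_prod_beta
      by (intro continuous_intros contK) auto
  qed (use yhmem in auto)
  have "continuous_map (top_of_set ?K) (top_of_set ?Z) ?g"
  proof -
    have "continuous_on ?K ?g"
      by (intro continuous_intros y(1) conth)
    moreover have "?g ` ?K \<subseteq> ?Z" using yhmem[of _ _ 1] by auto
    ultimately show ?thesis by (auto simp: continuous_map_subtopology_eu)
  qed
  moreover have "continuous_map (top_of_set ?Z) (top_of_set ?K) snd"
    by (auto simp: continuous_map_subtopology_eu intro: continuous_intros)
  moreover have "homotopic_with (\<lambda>h. True) (top_of_set ?K) (top_of_set ?K) (snd \<circ> ?g) id"
    using K_id by (simp add: homotopic_with_sym comp_def)
  moreover have "homotopic_with (\<lambda>h. True) (top_of_set ?Z) (top_of_set ?Z) (?g \<circ> snd) id"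
    using homotopic_with_trans[OF id_h h_gf] by (simp only: homotopic_with_sym)
  ultimately show ?thesis
    unfolding homotopy_equivalence_map_def by blast
qed

section \<open>The projection to the multicover\<close>

text \<open>The tent function, whose integer translates form a partition of unity on the line; they
  distribute mass between two consecutive levels.\<close>

definition hat :: "real \<Rightarrow> real" where
  "hat u = max 0 (1 - \<bar>u\<bar>)"

lemma hat_nonneg: "0 \<le> hat u"
  by (simp add: hat_def)

lemma hat_diff_nat_nonzero:
  assumes "hat (s - real c) \<noteq> 0" "real i \<le> s" "s \<le> real (Suc i)"
  shows "c = i \<or> c = Suc i"
  using assms by (auto simp: hat_def max_def split: if_splits)

lemma hat_sum: "real i \<le> s \<Longrightarrow> s \<le> real (Suc i) \<Longrightarrow> hat (s - real i) + hat (s - real (Suc i)) = 1"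
  by (auto simp: hat_def)

text \<open>A weighted mean of the values \<open>i\<close> and \<open>Suc i\<close> lies between
  them. It measures the height of \<open>f\<close> in the chain of simplices continuously, whereas
  the level \<open>i\<close> is an ambiguous integer.\<close>

lemma mean_card_bounds:
  assumes "(x, f) \<in> incidence A r k" and card: "\<And>v. f v \<noteq> 0 \<Longrightarrow> card v = i \<or> card v = Suc i"
  defines "s \<equiv> \<Sum>v\<in>Pow A. real (card v) * f v"
  shows "real i \<le> s" "s \<le> real (Suc i)"
proof -
  have f: "\<And>v. 0 \<le> f v" "(\<Sum>v\<in>Pow A. f v) = 1"
    using assms(1) by (auto simp: incidence_def)
  have bounds: "real i * f v \<le> real (card v) * f v \<and> real (card v) * f v \<le> real (Suc i) * f v" for v
  proof (cases "f v = 0")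
    case False
    then show ?thesis using f(1)[of v] card[of v] by (auto intro!: mult_right_mono)
  qed simp
  show "real i \<le> s"
  proof -
    have "real i = (\<Sum>v\<in>Pow A. real i * f v)" using f(2) by (simp flip: sum_distrib_left)
    also have "\<dots> \<le> s" unfolding s_def using bounds by (intro sum_mono) blast
    finally show ?thesis .
  qed
  show "s \<le> real (Suc i)"
  proof -
    have "s \<le> (\<Sum>v\<in>Pow A. real (Suc i) * f v)" unfolding s_def using bounds by (intro sum_mono) blast
    also have "\<dots> = real (Suc i)" unfolding sum_distrib_left[symmetric] f(2) by simp
    finally show ?thesis .
  qed
qed

text \<open>A mean above \<open>i\<close> forces a vertex with \<open>Suc i\<close> points into the
  support, and its cell places \<open>x\<close> in the deeper cover. This is what a chain point at
  height \<open>s\<close> requires of \<open>x\<close>.\<close>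

lemma incidence_level:
  assumes "finite A" "(x, f) \<in> incidence A r k"
  defines "s \<equiv> \<Sum>v\<in>Pow A. real (card v) * f v"
  obtains i where "k \<le> i" "real i \<le> s" "s \<le> real (Suc i)"
    "x \<in> Cov A r i" "real i < s \<longrightarrow> x \<in> Cov A r (Suc i)"
  using assms(2)
proof (rule incidenceE)
  fix i assume f: "\<And>v. 0 \<le> f v" "\<And>v. f v \<noteq> 0 \<Longrightarrow> v \<subseteq> A" "\<And>v. f v \<noteq> 0 \<Longrightarrow> x \<in> cell A r v"
    "k \<le> i" "\<And>v. f v \<noteq> 0 \<Longrightarrow> card v = i \<or> card v = Suc i" "(\<Sum>v\<in>Pow A. f v) = 1"
  have lo: "real i \<le> s" and hi: "s \<le> real (Suc i)"
    using mean_card_bounds[OF assms(2) f(5)] unfolding s_def by auto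
  have cov: "x \<in> Cov A r (card v)" if "f v \<noteq> 0" for v
    using cell_subset_Cov[OF assms(1) f(2)[OF that]] f(3)[OF that] by blast
  have ne: "\<exists>v. f v \<noteq> 0" using f(6) by (metis sum.neutral zero_neq_one)
  have "x \<in> Cov A r i"
    using ne cov f(5) Cov_antimono[of i "Suc i" A r] by (metis le_Suc_eq order_refl subsetD)
  moreover have "x \<in> Cov A r (Suc i)" if "real i < s"
  proof -
    have "\<exists>v. f v \<noteq> 0 \<and> card v \<noteq> i"
    proof (rule ccontr)
      assume "\<not> (\<exists>v. f v \<noteq> 0 \<and> card v \<noteq> i)"
      then have "s = (\<Sum>v\<in>Pow A. real i * f v)"
        unfolding s_def by (intro sum.cong) auto
      then show False using that f(6) by (simp flip: sum_distrib_left)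
    qed
    then show ?thesis using cov f(5) by metis
  qed
  ultimately show thesis using that f(4) lo hi by blast
qed

text \<open>The inverse sends \<open>x\<close> to \<open>y x\<close> with the lowest chain point
  \<open>T (real k) x\<close>. It is reached from the identity in three stages: slide
  \<open>x\<close> to \<open>y x\<close>, replace \<open>f\<close> by the chain point at its own
  height, then lower that height to \<open>k\<close>.\<close>

lemma homotopy_equivalence_fst:
  fixes A :: "'a::euclidean_space set"
  assumes fin: "finite A" and k: "1 \<le> k"
  shows "homotopy_equivalence_map (top_of_set (incidence A r k)) (top_of_set (Cov A r k)) fst"
proof -
  let ?Z = "incidence A r k" and ?X = "Cov A r k"
  \<comment> \<open>Empty cells are left out because \<open>infdist x {} = 0\<close>.\<close>
  define V where "V = {v. v \<subseteq> A \<and> cell A r v \<noteq> {}}"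
  have finV: "finite V" using fin by (simp add: V_def)
  define d where "d v x = infdist x (cell A r v)" for v and x :: 'a
  have "\<exists>\<epsilon>>0. \<forall>x\<in>?X. \<forall>\<sigma>\<subseteq>V. (\<forall>v\<in>\<sigma>. d v x < \<epsilon>) \<longrightarrow> (\<exists>z. \<forall>v\<in>\<sigma>. z \<in> cell A r v)"
    unfolding d_def
    by (rule thickened_nerve[OF compact_Cov[OF fin k] finV closed_cell]) (simp add: V_def)
  then obtain \<epsilon> where \<epsilon>: "0 < \<epsilon>"
    "\<forall>x\<in>?X. \<forall>\<sigma>\<subseteq>V. (\<forall>v\<in>\<sigma>. d v x < \<epsilon>) \<longrightarrow> (\<exists>z. \<forall>v\<in>\<sigma>. z \<in> cell A r v)"
    by blast
  \<comment> \<open>Cells within \<open>\<epsilon>\<close> of \<open>x\<close> have a common point,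
    so they may be averaged over; \<open>y x\<close> lands in all nonempty cells within
    \<open>\<epsilon> / 2\<close>. The gap between the two radii keeps \<open>\<alpha>\<close> and
    \<open>\<beta>\<close> from vanishing together.\<close>
  obtain y where y: "continuous_on ?X y"
    "\<And>x v. x \<in> ?X \<Longrightarrow> v \<in> V \<Longrightarrow> max 0 (d v x - \<epsilon> / 2) = 0 \<Longrightarrow> y x \<in> cell A r v"
  proof (rule convex_selection[where V = V and C = "cell A r" and T = ?X
        and \<alpha> = "\<lambda>v x. max 0 (\<epsilon> - d v x)" and \<beta> = "\<lambda>v x. max 0 (d v x - \<epsilon> / 2)"])
    show "\<exists>z. \<forall>v\<in>V. 0 < max 0 (\<epsilon> - d v x) \<longrightarrow> z \<in> cell A r v" if "x \<in> ?X" for x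
      using \<epsilon>(2)[THEN bspec, OF that, THEN spec, of "{v\<in>V. d v x < \<epsilon>}"]
      by (simp add: less_max_iff_disj subset_eq Ball_def imp_conjL)
    show "0 < max 0 (\<epsilon> - d v x) \<or> 0 < max 0 (d v x - \<epsilon> / 2)" for v x
      using \<epsilon>(1) by auto
    show "continuous_on ?X (\<lambda>x. max 0 (\<epsilon> - d v x))" "continuous_on ?X (\<lambda>x. max 0 (d v x - \<epsilon> / 2))" for v
      unfolding d_def by (intro continuous_intros)+
  qed (use finV convex_cell in auto)
  \<comment> \<open>This weight is positive only on cells within \<open>\<epsilon> / 2\<close>, all
    of which contain \<open>y x\<close>. They may miss \<open>x\<close>, so the chain point is
    placed over \<open>y x\<close>.\<close>
  define \<tau> where "\<tau> v x = (if v \<in> V then max 0 (\<epsilon> / 2 - d v x) else 0)" for v x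
  define S where "S i x = (\<Sum>v\<in>{v \<in> Pow A. card v = i}. \<tau> v x)" for i x
  \<comment> \<open>The point at height \<open>s\<close> of the chain of simplices over \<open>x\<close>, with mass only on the levels
    adjacent to \<open>s\<close>. On \<open>Cov A r i\<close> the \<open>max\<close> is just \<open>S i x\<close>; it keeps \<open>T\<close> continuous elsewhere.\<close>
  define T where "T s x v = hat (s - real (card v)) * (\<tau> v x / max (\<epsilon> / 2) (S (card v) x))" for s x v
  have \<tau>0: "0 \<le> \<tau> v x" for v x by (simp add: \<tau>_def)
  have \<tau>_cell: "v \<in> V \<and> y x \<in> cell A r v" if "x \<in> ?X" "\<tau> v x \<noteq> 0" for x v
    using that y(2)[of x v] by (auto simp: \<tau>_def split: if_splits)
  have cell_V: "v \<in> V" "d v x = 0" if "v \<subseteq> A" "x \<in> cell A r v" for v x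
    using that by (auto simp: V_def d_def)
  have y_cell: "y x \<in> cell A r v" if "x \<in> ?X" "v \<subseteq> A" "x \<in> cell A r v" for x v
    using y(2)[OF that(1) cell_V(1)[OF that(2,3)]] cell_V(2)[OF that(2,3)] \<epsilon>(1) by simp
  \<comment> \<open>Some cell of \<open>i\<close> points contains \<open>x\<close>, and its term
    alone is \<open>\<epsilon> / 2\<close>.\<close>
  have S_ge: "\<epsilon> / 2 \<le> S i x" if x: "x \<in> Cov A r i" for i x
  proof -
    obtain v where v: "v \<subseteq> A" "card v = i" "x \<in> cell A r v" using Cov_in_cell[OF fin x] .
    then have "\<tau> v x = \<epsilon> / 2" using cell_V[of v x] \<epsilon>(1) by (simp add: \<tau>_def)
    moreover have "\<tau> v x \<le> S i x"
      unfolding S_def using v fin \<tau>0 by (intro member_le_sum) auto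
    ultimately show ?thesis by simp
  qed
  have T0: "0 \<le> T s x v" for s x v
    using \<tau>0 hat_nonneg \<epsilon>(1) unfolding T_def by (intro mult_nonneg_nonneg divide_nonneg_nonneg) auto
  have T_nonzero: "hat (s - real (card v)) \<noteq> 0" "\<tau> v x \<noteq> 0" if "T s x v \<noteq> 0" for s x v
    using that by (auto simp: T_def)
  have T_level: "(\<Sum>v\<in>{v \<in> Pow A. card v = i}. T s x v) = hat (s - real i)" if "x \<in> Cov A r i" for s x i
  proof -
    have "(\<Sum>v\<in>{v \<in> Pow A. card v = i}. T s x v) =
        (\<Sum>v\<in>{v \<in> Pow A. card v = i}. hat (s - real i) * (\<tau> v x / S i x))"
      using S_ge[OF that] by (intro sum.cong) (auto simp: T_def max_def)
    also have "\<dots> = hat (s - real i) * (S i x / S i x)"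
      unfolding S_def[of i x] by (simp flip: sum_distrib_left sum_divide_distrib)
    also have "\<dots> = hat (s - real i)" using S_ge[OF that] \<epsilon>(1) by simp
    finally show ?thesis .
  qed
  have T_sum: "(\<Sum>v\<in>Pow A. T s x v) = 1"
    if "x \<in> Cov A r i" "real i \<le> s" "s \<le> real (Suc i)" "real i < s \<Longrightarrow> x \<in> Cov A r (Suc i)" for x s i
  proof -
    let ?P = "\<lambda>j. {v \<in> Pow A. card v = j}"
    have T_zero: "T s x v = 0" if "card v \<noteq> i" "card v \<noteq> Suc i" for v
      using hat_diff_nat_nonzero[of s "card v" i] \<open>real i \<le> s\<close> \<open>s \<le> real (Suc i)\<close> that
      by (auto simp: T_def)
    have "(\<Sum>v\<in>Pow A. T s x v) = (\<Sum>v\<in>?P i \<union> ?P (Suc i). T s x v)"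
      using fin T_zero by (intro sum.mono_neutral_right) auto
    also have "\<dots> = (\<Sum>v\<in>?P i. T s x v) + (\<Sum>v\<in>?P (Suc i). T s x v)"
      using fin by (intro sum.union_disjoint) auto
    also have "(\<Sum>v\<in>?P (Suc i). T s x v) = hat (s - real (Suc i))"
    proof (cases "real i < s")
      case True
      then show ?thesis using that T_level by blast
    next
      \<comment> \<open>At \<open>s = i\<close> the upper tent vanishes, so membership in
        \<open>Cov A r (Suc i)\<close> is demanded only for \<open>s > i\<close>.\<close>
      case False
      then have "hat (s - real (Suc i)) = 0" using that by (simp add: hat_def)
      then show ?thesis by (auto intro!: sum.neutral simp: T_def)
    qed
    finally show ?thesis using T_level[OF that(1)] hat_sum that by simp
  qed
  have T_mem: "(y x, T s x) \<in> ?Z"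
    if "k \<le> i" "x \<in> Cov A r i" "real i \<le> s" "s \<le> real (Suc i)" "real i < s \<Longrightarrow> x \<in> Cov A r (Suc i)" for x s i
  proof -
    have x: "x \<in> ?X" using that(1,2) Cov_antimono by blast
    show ?thesis
    proof (rule incidenceI[OF _ _ _ that(1)])
      show "v \<subseteq> A" if "T s x v \<noteq> 0" for v
        using \<tau>_cell[OF x T_nonzero(2)[OF that]] by (simp add: V_def)
      show "y x \<in> cell A r v" if "T s x v \<noteq> 0" for v
        using \<tau>_cell[OF x T_nonzero(2)[OF that]] by simp
      show "card v = i \<or> card v = Suc i" if "T s x v \<noteq> 0" for v
        using hat_diff_nat_nonzero[OF T_nonzero(1)[OF that]] \<open>real i \<le> s\<close> \<open>s \<le> real (Suc i)\<close> by blast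
      show "(\<Sum>v\<in>Pow A. T s x v) = 1" using T_sum that by blast
    qed (rule T0)
  qed
  define level where "level f = (\<Sum>v\<in>Pow A. real (card v) * f v)" for f :: "'a set \<Rightarrow> real"
  have fstX: "x \<in> ?X" if "(x, f) \<in> ?Z" for x f
    using incidence_level[OF fin that] Cov_antimono by (metis subsetD)
  \<comment> \<open>Stage one: every cell that contains \<open>x\<close> also contains
    \<open>y x\<close>, so \<open>f\<close> can stay fixed.\<close>
  have H1: "((1 - s) *\<^sub>R x + s *\<^sub>R y x, f) \<in> ?Z" if z: "(x, f) \<in> ?Z" and s: "0 \<le> s" "s \<le> 1" for x f s
  proof (rule incidence_support_mono[OF z])
    show "(1 - s) *\<^sub>R x + s *\<^sub>R y x \<in> cell A r v" if "f v \<noteq> 0" for v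
    proof (rule convexD_alt[OF convex_cell _ _ s])
      show "x \<in> cell A r v" "y x \<in> cell A r v"
        using that z y_cell[OF fstX[OF z]] by (auto simp: incidence_def)
    qed
  qed (use z in \<open>auto simp: incidence_def\<close>)
  \<comment> \<open>Stage two: over \<open>y x\<close>, the point \<open>f\<close> and the chain
    point at its mean cardinality occupy the same two levels, so the segment joining them stays in
    the fibre.\<close>
  have H2: "(y x, \<lambda>v. (1 - s) * f v + s * T (level f) x v) \<in> ?Z"
    if z: "(x, f) \<in> ?Z" and s: "0 \<le> s" "s \<le> 1" for x f s
  proof -
    obtain i where i: "k \<le> i" "real i \<le> level f" "level f \<le> real (Suc i)"
      "x \<in> Cov A r i" "real i < level f \<longrightarrow> x \<in> Cov A r (Suc i)"
      using incidence_level[OF fin z, folded level_def] .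
    have T: "(y x, T (level f) x) \<in> ?Z" using T_mem i by blast
    have yf: "(y x, f) \<in> ?Z" using H1[OF z, of 1] by simp
    show ?thesis
    proof (rule incidence_convex_combination[OF yf s])
      fix j and v :: "'a set"
      assume j: "\<And>v. f v \<noteq> 0 \<Longrightarrow> card v = j \<or> card v = Suc j" and v: "T (level f) x v \<noteq> 0"
      have "real j \<le> level f" "level f \<le> real (Suc j)"
        using mean_card_bounds[OF z j] by (simp_all add: level_def)
      with v show "card v = j \<or> card v = Suc j"
        using hat_diff_nat_nonzero[OF T_nonzero(1)[OF v]] by blast
    qed (use T in \<open>auto simp: incidence_def\<close>)
  qed
  \<comment> \<open>Stage three: lowering the height only weakens the covering conditions, since the
    multicover grows as the level drops.\<close>
  have H3: "(y x, T ((1 - s) * level f + s * real k) x) \<in> ?Z"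
    if z: "(x, f) \<in> ?Z" and s: "0 \<le> s" "s \<le> 1" for x f s
  proof -
    obtain i where i: "k \<le> i" "real i \<le> level f" "level f \<le> real (Suc i)"
      "x \<in> Cov A r i" "real i < level f \<longrightarrow> x \<in> Cov A r (Suc i)"
      using incidence_level[OF fin z, folded level_def] .
    let ?t = "(1 - s) * level f + s * real k"
    have "0 \<le> s * (level f - real k)" "0 \<le> (1 - s) * (level f - real k)"
      using s i(1,2) by simp_all
    then have t: "real k \<le> ?t" "?t \<le> level f"
      by (simp_all add: algebra_simps)
    define j where "j = nat \<lfloor>?t\<rfloor>"
    have j: "k \<le> j" "real j \<le> ?t" "?t \<le> real (Suc j)"
      using t(1) unfolding j_def by linarith+
    show ?thesis
    proof (rule T_mem[OF j(1) _ j(2,3)])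
      \<comment> \<open>The integer part can reach \<open>Suc i\<close>, but only if
        \<open>level f\<close> exceeds \<open>i\<close>, and then \<open>x\<close> lies in
        \<open>Cov A r (Suc i)\<close> as well.\<close>
      have "j \<le> i" if "\<not> real i < level f" using j t(2) that by linarith
      moreover have "j \<le> Suc i" using j t(2) i(3) by linarith
      ultimately show "x \<in> Cov A r j" using i(4,5) Cov_antimono by (metis subsetD)
      assume "real j < ?t"
      then have "Suc j \<le> i \<or> real i < level f \<and> Suc j \<le> Suc i"
        using t(2) i(3) by linarith
      then show "x \<in> Cov A r (Suc j)" using i(4,5) Cov_antimono by (metis subsetD)
    qed
  qed
  have T_k: "(y x, T (real k) x) \<in> ?Z" if "x \<in> ?X" for x
    using that by (intro T_mem[where i = k]) auto
  have cont_T: "continuous_on D (\<lambda>z. T (s z) (p z) v)"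
    if s: "continuous_on D s" and p: "continuous_on D p"
    for D :: "'c::topological_space set" and s p v
  proof -
    have c\<tau>: "continuous_on D (\<lambda>z. \<tau> w (p z))" for w
      unfolding \<tau>_def d_def by (cases "w \<in> V") (auto intro!: continuous_intros p)
    have "continuous_on D (\<lambda>z. S i (p z))" for i
      unfolding S_def by (intro continuous_intros c\<tau>)
    then show ?thesis
      unfolding T_def hat_def using \<epsilon>(1) by (intro continuous_intros s c\<tau>) (auto simp: max_def)
  qed
  have cont_y: "continuous_on D (\<lambda>z. y (p z))" if "continuous_on D p" "p ` D \<subseteq> ?X"
    for D :: "'c::topological_space set" and p
    using continuous_on_compose2[OF y(1) that] by auto
  let ?g = "\<lambda>x. (y x, T (real k) x)"
  have "homotopic_with (\<lambda>h. True) (top_of_set ?Z) (top_of_set ?Z) id (\<lambda>z. (y (fst z), snd z))"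
  proof (rule homotopic_into_top_of_set[where H = "\<lambda>(s, z). ((1 - s) *\<^sub>R fst z + s *\<^sub>R y (fst z), snd z)"])
    show "continuous_on ({0..1} \<times> ?Z) (\<lambda>(s, z). ((1 - s) *\<^sub>R fst z + s *\<^sub>R y (fst z), snd z))"
      unfolding case_prod_beta by (intro continuous_intros cont_y) (auto dest: fstX)
  qed (use H1 in auto)
  moreover have "homotopic_with (\<lambda>h. True) (top_of_set ?Z) (top_of_set ?Z)
      (\<lambda>z. (y (fst z), snd z)) (\<lambda>z. (y (fst z), T (level (snd z)) (fst z)))"
  proof (rule homotopic_into_top_of_set[where
        H = "\<lambda>(s, z). (y (fst z), \<lambda>v. (1 - s) * snd z v + s * T (level (snd z)) (fst z) v)"])
    show "continuous_on ({0..1} \<times> ?Z)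
        (\<lambda>(s, z). (y (fst z), \<lambda>v. (1 - s) * snd z v + s * T (level (snd z)) (fst z) v))"
      unfolding case_prod_beta level_def
      by (intro continuous_intros cont_y cont_T continuous_on_product_then_coordinatewise) (auto dest: fstX)
  qed (use H2 in auto)
  moreover have "homotopic_with (\<lambda>h. True) (top_of_set ?Z) (top_of_set ?Z)
      (\<lambda>z. (y (fst z), T (level (snd z)) (fst z))) (?g \<circ> fst)"
  proof (rule homotopic_into_top_of_set[where
        H = "\<lambda>(s, z). (y (fst z), T ((1 - s) * level (snd z) + s * real k) (fst z))"])
    have "continuous_on ({0..1} \<times> ?Z)
        (\<lambda>z. (y (fst (snd z)), \<lambda>v. T ((1 - fst z) * level (snd (snd z)) + fst z * real k) (fst (snd z)) v))"
      unfolding level_def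
      by (intro continuous_intros cont_y cont_T continuous_on_product_then_coordinatewise) (auto dest: fstX)
    then show "continuous_on ({0..1} \<times> ?Z)
        (\<lambda>(s, z). (y (fst z), T ((1 - s) * level (snd z) + s * real k) (fst z)))"
      by (simp add: case_prod_beta)
  qed (use H3 in auto)
  ultimately have "homotopic_with (\<lambda>h. True) (top_of_set ?Z) (top_of_set ?Z) id (?g \<circ> fst)"
    by (meson homotopic_with_trans)
  then have gf: "homotopic_with (\<lambda>h. True) (top_of_set ?Z) (top_of_set ?Z) (?g \<circ> fst) id"
    by (simp only: homotopic_with_sym)
  have "homotopic_with (\<lambda>h. True) (top_of_set ?X) (top_of_set ?X) id y"
  proof (rule homotopic_into_top_of_set[where H = "\<lambda>(s, x). (1 - s) *\<^sub>R x + s *\<^sub>R y x"])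
    show "continuous_on ({0..1} \<times> ?X) (\<lambda>(s, x). (1 - s) *\<^sub>R x + s *\<^sub>R y x)"
      unfolding case_prod_beta by (intro continuous_intros cont_y) auto
    fix s :: real and x assume s: "0 \<le> s" "s \<le> 1" and x: "x \<in> ?X"
    \<comment> \<open>A cell of \<open>k\<close> points around \<open>x\<close> contains
      \<open>y x\<close> too; the segment stays in this convex cell and hence in the cover.\<close>
    obtain v where v: "v \<subseteq> A" "card v = k" "x \<in> cell A r v" using Cov_in_cell[OF fin x] .
    have "(1 - s) *\<^sub>R x + s *\<^sub>R y x \<in> cell A r v"
      using convexD_alt[OF convex_cell v(3) y_cell[OF x v(1,3)] s] .
    then show "(case (s, x) of (s, x) \<Rightarrow> (1 - s) *\<^sub>R x + s *\<^sub>R y x) \<in> ?X"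
      using cell_subset_Cov[OF fin v(1)] v(2) by auto
  qed auto
  then have fg: "homotopic_with (\<lambda>h. True) (top_of_set ?X) (top_of_set ?X) (fst \<circ> ?g) id"
    by (simp add: homotopic_with_sym comp_def)
  have "continuous_on ?X ?g"
    by (intro continuous_on_Pair y(1) continuous_on_coordinatewise_then_product cont_T continuous_intros)
  then have "continuous_map (top_of_set ?X) (top_of_set ?Z) ?g"
    using T_k by auto
  moreover have "continuous_map (top_of_set ?Z) (top_of_set ?X) fst"
    using fstX by (auto intro: continuous_intros)
  ultimately show ?thesis
    unfolding homotopy_equivalence_map_def using gf fg by blast
qed

section \<open>Encoding the incidence space in real sequences\<close>

lemma homotopy_equivalence_map_homeomorphic:
  assumes "homotopy_equivalence_map X Y f"
    and e: "continuous_map X X' e" "continuous_map X' X e'"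
      "\<And>x. x \<in> topspace X \<Longrightarrow> e' (e x) = x" "\<And>z. z \<in> topspace X' \<Longrightarrow> e (e' z) = z"
  shows "homotopy_equivalence_map X' Y (f \<circ> e')"
proof -
  obtain g where f: "continuous_map X Y f" and g: "continuous_map Y X g"
    and gf: "homotopic_with (\<lambda>h. True) X X (g \<circ> f) id"
    and fg: "homotopic_with (\<lambda>h. True) Y Y (f \<circ> g) id"
    using assms(1) unfolding homotopy_equivalence_map_def by blast
  have "homotopic_with (\<lambda>h. True) X' X ((g \<circ> f) \<circ> e') (id \<circ> e')"
    by (rule homotopic_with_compose_continuous_map_right[OF gf e(2)]) simp
  then have "homotopic_with (\<lambda>h. True) X' X' (e \<circ> ((g \<circ> f) \<circ> e')) (e \<circ> (id \<circ> e'))"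
    by (rule homotopic_with_compose_continuous_map_left[OF _ e(1)]) simp
  then have "homotopic_with (\<lambda>h. True) X' X' ((e \<circ> g) \<circ> (f \<circ> e')) id"
    by (rule homotopic_with_eq) (use e(4) in auto)
  moreover have "homotopic_with (\<lambda>h. True) Y Y ((f \<circ> e') \<circ> (e \<circ> g)) id"
    using fg by (rule homotopic_with_eq) (use e(3) continuous_map_image_subset_topspace[OF g] in auto)
  moreover have "continuous_map X' Y (f \<circ> e')" "continuous_map Y X' (e \<circ> g)"
    using e f g continuous_map_compose by blast+
  ultimately show ?thesis
    unfolding homotopy_equivalence_map_def by blast
qed

text \<open>Intermediate spaces of a zigzag consist of real sequences: even positions hold the
  coordinates of the point, odd ones the barycentric weights. For finite \<open>A\<close>, positions
  past the last index repeat some entry, which \<open>decode\<close> never reads.\<close>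

definition encode :: "'a set \<Rightarrow> 'a::euclidean_space \<times> ('a set \<Rightarrow> real) \<Rightarrow> nat \<Rightarrow> real" where
  "encode A z n = (if even n then fst z \<bullet> from_nat_into Basis (n div 2)
     else snd z (from_nat_into (Pow A) (n div 2)))"

text \<open>The default 0 off \<open>Pow A\<close> agrees with points of the incidence space, whose
  weights vanish there.\<close>

definition decode :: "'a set \<Rightarrow> (nat \<Rightarrow> real) \<Rightarrow> 'a::euclidean_space \<times> ('a set \<Rightarrow> real)" where
  "decode A z = ((\<Sum>b\<in>Basis. z (2 * to_nat_on Basis b) *\<^sub>R b),
     \<lambda>v. if v \<subseteq> A then z (Suc (2 * to_nat_on (Pow A) v)) else 0)"

lemma continuous_on_encode: "continuous_on S (encode A)"
  unfolding encode_def
proof (rule continuous_on_coordinatewise_then_product)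
  show "continuous_on S (\<lambda>z. if even n then fst z \<bullet> from_nat_into Basis (n div 2)
     else snd z (from_nat_into (Pow A) (n div 2)))" for n
  proof (cases "even n")
    case False
    have "continuous_on S (\<lambda>z. snd z (from_nat_into (Pow A) (n div 2)))"
      by (rule continuous_on_product_then_coordinatewise[OF continuous_on_snd[OF continuous_on_id]])
    with False show ?thesis by simp
  qed (auto intro!: continuous_intros)
qed

lemma continuous_on_decode: "continuous_on S (decode A)"
proof -
  have z: "continuous_on S (\<lambda>z. z n)" for n :: nat and S :: "(nat \<Rightarrow> real) set"
    by (rule continuous_on_product_then_coordinatewise[OF continuous_on_id])
  have "continuous_on S (\<lambda>z. if v \<subseteq> A then z (Suc (2 * to_nat_on (Pow A) v)) else 0 :: real)" for v
    by (cases "v \<subseteq> A") (auto intro!: z)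
  then show ?thesis
    unfolding decode_def by (intro continuous_intros z)
qed

lemma decode_encode:
  assumes "finite A" "\<And>v. f v \<noteq> 0 \<Longrightarrow> v \<subseteq> A"
  shows "decode A (encode A (x, f)) = (x, f)"
proof -
  have "(\<Sum>b\<in>Basis. (x \<bullet> from_nat_into Basis (to_nat_on Basis b)) *\<^sub>R b) = (\<Sum>b\<in>Basis. (x \<bullet> b) *\<^sub>R b)"
    by (intro sum.cong) (simp_all add: countable_finite)
  moreover have "countable (Pow A)" using assms(1) by (simp add: countable_finite)
  ultimately show ?thesis
    using assms(2) by (auto simp: decode_def encode_def euclidean_representation fun_eq_iff)
qed

text \<open>One encoding serves all \<open>r\<close> and \<open>k\<close>, so inclusions of
  incidence spaces remain literal inclusions.\<close>

definition incidence_bifil :: "'a::euclidean_space set \<Rightarrow> real \<Rightarrow> nat \<Rightarrow> (nat \<Rightarrow> real) topology" where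
  "incidence_bifil A r k = top_of_set (encode A ` incidence A r k)"

lemma decode_encode_incidence:
  assumes "finite A" "z \<in> incidence A r k"
  shows "decode A (encode A z) = z"
proof (cases z)
  case (Pair x f)
  then have "v \<subseteq> A" if "f v \<noteq> 0" for v
    using assms(2) that by (simp add: incidence_def)
  then show ?thesis
    using decode_encode[OF assms(1)] Pair by blast
qed

lemma is_bifiltration_incidence: "is_bifiltration (incidence_bifil A)"
  unfolding is_bifiltration_def
proof (intro allI impI)
  fix r k r' k' assume "idx_le r k r' k'"
  then have "encode A ` incidence A r k \<subseteq> encode A ` incidence A r' k'"
    using incidence_mono[of r r' k' k A] by (auto simp: idx_le_def)
  then show "topspace (incidence_bifil A r k) \<subseteq> topspace (incidence_bifil A r' k') \<and>
      continuous_map (incidence_bifil A r k) (incidence_bifil A r' k') id"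
    by (auto simp: incidence_bifil_def)
qed

lemma homotopy_equivalence_decode:
  assumes "finite A" "homotopy_equivalence_map (top_of_set (incidence A r k)) Y f"
  shows "homotopy_equivalence_map (incidence_bifil A r k) Y (f \<circ> decode A)"
  unfolding incidence_bifil_def
proof (rule homotopy_equivalence_map_homeomorphic[OF assms(2), where e = "encode A"])
  show "continuous_map (top_of_set (incidence A r k)) (top_of_set (encode A ` incidence A r k)) (encode A)"
    using continuous_on_encode by auto
  show "continuous_map (top_of_set (encode A ` incidence A r k)) (top_of_set (incidence A r k)) (decode A)"
    using continuous_on_decode decode_encode_incidence[OF assms(1)] by auto
qed (use decode_encode_incidence[OF assms(1)] in auto)

section \<open>The zigzag through the incidence space\<close>

theorem theorem4:
  fixes A :: "'a::euclidean_space set"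
  assumes "finite A"
  shows "weakly_equivalent (Cov_bifil A) (SDel_bifil A)"
proof -
  \<comment> \<open>Neither projection depends on \<open>r\<close> or \<open>k\<close>, so
    compatibility with the inclusions is immediate.\<close>
  have "objectwise_he (incidence_bifil A) (Cov_bifil A) (\<lambda>r k. fst \<circ> decode A)"
    unfolding objectwise_he_def Cov_bifil_def
    using homotopy_equivalence_decode[OF assms homotopy_equivalence_fst[OF assms]] by blast
  moreover have "objectwise_he (incidence_bifil A) (SDel_bifil A) (\<lambda>r k. snd \<circ> decode A)"
    unfolding objectwise_he_def SDel_bifil_def realization_SDel[OF assms]
    using homotopy_equivalence_decode[OF assms homotopy_equivalence_snd[OF assms]] by blast
  ultimately show ?thesis
    unfolding weakly_equivalent_def he_linked_def
    \<comment> \<open>With \<open>n = 0\<close> the zigzag has one intermediate object, and both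
      arrows point out of it.\<close>
    by (intro exI[of _ 0] exI[of _ "\<lambda>i. incidence_bifil A"]) (auto intro: is_bifiltration_incidence)
qed

end
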